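(* Let $n$ be a positive integer. Let either $(\lambda_0,\ldots,\lambda_n)$ be a partition and $k_1,k_2\ge\lambda_0$ integers, or $(\lambda_0,\ldots,\lambda_n)$ be a half-partition and $k_1,k_2\ge\lambda_0$ half-integers. Then $$\prod_{i=1}^n\bigl(x_i^{1/2}+\bar{x}_i^{1/2}\bigr)\,\Bigl(s_{(k_1+\lambda_1,\ldots,k_1+\lambda_n,k_1-\lambda_{n-1},\ldots,k_1-\lambda_0)}(x_1,\ldots,x_n,\bar{x}_1,\ldots,\bar{x}_n)$$ $$\qquad{}+s_{(k_2+\lambda_1,\ldots,k_2+\lambda_{n-1},k_2-\lambda_n,\ldots,k_2-\lambda_0)}(x_1,\ldots,x_n,\bar{x}_1,\ldots,\bar{x}_n)\Bigr)$$ $$=(1+\delta_{\lambda_n,0})\;\mathit{so}^{\mathrm{odd}}_{(\lambda_0+1/2,\ldots,\lambda_{n-1}+1/2)}(x_1,\ldots,x_n)\; o^{\mathrm{even}}_{(\lambda_1,\ldots,\lambda_n)}(x_1,\ldots,x_n).$$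
   Context: A half-integer is an odd integer divided by 2. A partition (respectively half-partition) is a tuple whose entries are all nonnegative integers (respectively all positive half-integers) in weakly decreasing order; zero entries of a partition are kept explicitly. Here the tuple is indexed from $0$, so $\lambda_0\ge\lambda_1\ge\cdots\ge\lambda_n$. The $x_i$ are indeterminates, $\bar{x}=x^{-1}$, and half-integer powers are powers of a formal square root $x_i^{1/2}$, with $\bar{x}_i^{1/2}=(x_i^{1/2})^{-1}$. $\delta$ is the Kronecker delta. For a partition $\mu=(\mu_1,\ldots,\mu_N)$, the Schur polynomial is $$s_\mu(y_1,\ldots,y_N)=\frac{\det_{1\le i,j\le N}\bigl(y_i^{\mu_j+N-j}\bigr)}{\prod_{1\le i<j\le N}(y_i-y_j)}.$$ It is a symmetric polynomial in $y_1,\ldots,y_N$, which can be evaluated at arbitrary arguments. For a partition or half-partition $\mu=(\mu_1,\ldots,\mu_N)$, the odd orthogonal character is $$\mathit{so}^{\mathrm{odd}}_\mu(y_1,\ldots,y_N)=\frac{\det_{1\le i,j\le N}\bigl(y_i^{\mu_j+N-j+1/2}-\bar{y}_i^{\mu_j+N-j+1/2}\bigr)}{\prod_{i=1}^N\bigl(y_i^{1/2}-\bar{y}_i^{1/2}\bigr)\prod_{1\le i<j\le N}(y_i+\bar{y}_i-y_j-\bar{y}_j)},$$ and the even orthogonal character is $$o^{\mathrm{even}}_\mu(y_1,\ldots,y_N)=\frac{\det_{1\le i,j\le N}\bigl(y_i^{\mu_j+N-j}+\bar{y}_i^{\mu_j+N-j}\bigr)}{(1+\delta_{\mu_N,0})\prod_{1\le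 i<j\le N}(y_i+\bar{y}_i-y_j-\bar{y}_j)}.$$ *)

theory Defs
  imports
    Complex_Main
    "HOL-Library.Poly_Mapping"
    "HOL-Computational_Algebra.Fraction_Field"
    "Jordan_Normal_Form.Determinant"
begin

text \<open>
  Entries of partitions and half-partitions are rational numbers, so that the two cases share
  one type. Tuples are lists; the entry called \<open>\<mu>\<^sub>j\<close> (with \<open>1 \<le> j \<le> N\<close>) is \<open>\<mu> ! (j - 1)\<close>,
  hence \<open>N - j\<close> becomes \<open>N - 1 - j\<close> for a list index \<open>j\<close>.
\<close>

definition half_integer :: "rat \<Rightarrow> bool" where
  "half_integer a \<longleftrightarrow> (\<exists>m::int. odd m \<and> a = of_int m / 2)"

definition is_partition :: "rat list \<Rightarrow> bool" where
  "is_partition \<mu> \<longleftrightarrow> sorted_wrt (\<ge>) \<mu> \<and> (\<forall>a\<in>set \<mu>. a \<in> \<nat>)"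

definition is_half_partition :: "rat list \<Rightarrow> bool" where
  "is_half_partition \<mu> \<longleftrightarrow> sorted_wrt (\<ge>) \<mu> \<and> (\<forall>a\<in>set \<mu>. half_integer a \<and> a > 0)"

text \<open>
  \<open>half_power r a\<close> is \<open>y\<^sup>a\<close> for \<open>y = r\<^sup>2\<close> with chosen square root \<open>r\<close>, where \<open>2a\<close> is an integer
  (so the floor is exact).
\<close>

definition half_power :: "'k::field \<Rightarrow> rat \<Rightarrow> 'k" where
  "half_power r a = r powi \<lfloor>2 * a\<rfloor>"

text \<open>
  The Schur polynomial evaluated at a list \<open>y\<close> of pairwise distinct field elements; for such
  arguments the Vandermonde denominator is nonzero and the quotient is the value of the
  polynomial. The entries of \<open>\<mu>\<close> are integers (so the floor is exact).
\<close>

definition schur :: "rat list \<Rightarrow> 'k::field list \<Rightarrow> 'k" where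
  "schur \<mu> y = (let N = length \<mu> in
     det (mat N N (\<lambda>(i, j). (y ! i) powi \<lfloor>\<mu> ! j + of_nat (N - 1 - j)\<rfloor>))
     / (\<Prod>(i, j) \<in> {(i, j). i < j \<and> j < N}. y ! i - y ! j))"

text \<open>
  The product over \<open>i < j\<close> of \<open>y\<^sub>i + inverse y\<^sub>i - y\<^sub>j - inverse y\<^sub>j\<close>. Here and in both orthogonal
  characters the list argument \<open>r\<close> contains the square roots of the arguments: \<open>y\<^sub>i = (r ! i)\<^sup>2\<close>.
\<close>

definition orth_vandermonde :: "'k::field list \<Rightarrow> 'k" where
  "orth_vandermonde r =
     (\<Prod>(i, j) \<in> {(i, j). i < j \<and> j < length r}.
        (r ! i)\<^sup>2 + inverse ((r ! i)\<^sup>2) - (r ! j)\<^sup>2 - inverse ((r ! j)\<^sup>2))"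

definition so_odd :: "rat list \<Rightarrow> 'k::field list \<Rightarrow> 'k" where
  "so_odd \<mu> r = (let N = length \<mu> in
     det (mat N N (\<lambda>(i, j).
        half_power (r ! i) (\<mu> ! j + of_nat (N - 1 - j) + 1/2)
        - half_power (inverse (r ! i)) (\<mu> ! j + of_nat (N - 1 - j) + 1/2)))
     / ((\<Prod>i<N. r ! i - inverse (r ! i)) * orth_vandermonde r))"

definition o_even :: "rat list \<Rightarrow> 'k::field list \<Rightarrow> 'k" where
  "o_even \<mu> r = (let N = length \<mu> in
     det (mat N N (\<lambda>(i, j).
        half_power (r ! i) (\<mu> ! j + of_nat (N - 1 - j))
        + half_power (inverse (r ! i)) (\<mu> ! j + of_nat (N - 1 - j))))
     / ((1 + (if \<mu> ! (N - 1) = 0 then 1 else 0)) * orth_vandermonde r))"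

text \<open>
  The ambient field is the field of rational functions in the formal square roots
  \<open>x\<^sub>i\<^sup>1\<^sup>/\<^sup>2\<close> of the indeterminates, i.e. the fraction field of the polynomial ring in the
  variables \<open>xsqrt i\<close> over a coefficient domain \<open>'a\<close>.
\<close>

type_synonym 'a ratfun = "((nat \<Rightarrow>\<^sub>0 nat) \<Rightarrow>\<^sub>0 'a) fract"

definition xsqrt :: "nat \<Rightarrow> 'a::idom ratfun" where
  "xsqrt i = Fract (Poly_Mapping.single (Poly_Mapping.single i 1) 1) 1"

definition xvar :: "nat \<Rightarrow> 'a::idom ratfun" where
  "xvar i = (xsqrt i)\<^sup>2"

text \<open>
  The elements \<open>xvar i\<close> and their inverses are pairwise distinct, so no denominator above
  vanishes at the arguments \<open>x\<^sub>1, \<dots>, x\<^sub>n, inverse x\<^sub>1, \<dots>, inverse x\<^sub>n\<close>.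
\<close>

lemma xvar_eq_Fract:
  "(xvar i :: 'a::idom ratfun) = Fract (Poly_Mapping.single (Poly_Mapping.single i 2) 1) 1"
  by (simp add: xvar_def xsqrt_def numeral_2_eq_2 mult_single flip: single_add)

lemma xvar_nonzero: "(xvar i :: 'a::idom ratfun) \<noteq> 0"
proof -
  have "Poly_Mapping.single (Poly_Mapping.single i (2::nat)) (1::'a) \<noteq> 0"
    by (metis lookup_single_eq lookup_zero zero_neq_one)
  then show ?thesis
    by (simp add: xvar_eq_Fract Zero_fract_def eq_fract)
qed

lemma xvar_eq_iff: "(xvar i :: 'a::idom ratfun) = xvar j \<longleftrightarrow> i = j"
proof
  assume "(xvar i :: 'a ratfun) = xvar j"
  then have "Poly_Mapping.single (Poly_Mapping.single i (2::nat)) (1::'a)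
      = Poly_Mapping.single (Poly_Mapping.single j 2) 1"
    by (simp add: xvar_eq_Fract eq_fract)
  from arg_cong[OF this, of Poly_Mapping.keys] show "i = j"
    by (metis keys_single singleton_inject zero_neq_numeral zero_neq_one)
qed simp

lemma xvar_neq_inverse: "(xvar i :: 'a::idom ratfun) \<noteq> inverse (xvar j)"
proof
  assume "(xvar i :: 'a ratfun) = inverse (xvar j)"
  then have "(xvar i * xvar j :: 'a ratfun) = 1"
    by (simp add: xvar_nonzero)
  then have "Poly_Mapping.single (Poly_Mapping.single i (2::nat) + Poly_Mapping.single j 2) (1::'a) = 1"
    by (simp add: xvar_eq_Fract mult_single One_fract_def eq_fract)
  from arg_cong[OF this, of Poly_Mapping.keys]
  have "Poly_Mapping.single i (2::nat) + Poly_Mapping.single j 2 = 0"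
    by simp
  then have "Poly_Mapping.lookup (Poly_Mapping.single i (2::nat) + Poly_Mapping.single j 2) i = 0"
    by simp
  then show False
    by (simp add: lookup_add)
qed

end

theory Submission
  imports Defs
begin

text \<open>
  After multiplying the rows by suitable powers of their variables, whose product over
  \<open>x\<^sub>1, \<dots>, x\<^sub>n, 1/x\<^sub>1, \<dots>, 1/x\<^sub>n\<close> is 1, the numerators of the two Schur polynomials differ in the
  single column number \<open>n\<close>, so their sum is one determinant. Put \<open>a\<^sub>j = \<lambda>\<^sub>j + n - j\<close>. Adding the
  columns \<open>y^(- a\<^sub>j)\<close> to the columns \<open>y^a\<^sub>j\<close> makes the first \<open>n\<close> columns invariant under
  \<open>y \<mapsto> 1/y\<close>; subtracting the upper half of the rows from the lower half then gives a block
  triangular matrix whose diagonal blocks are the numerators of the even and the odd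
  orthogonal character, the latter with reversed columns. The sign of this reversal also
  appears when the Vandermonde product at \<open>x, 1/x\<close> is written as a product of the
  denominators of the two characters.
\<close>

section \<open>Determinant identities\<close>

text \<open>Laplace expansion along column \<open>k\<close>: its cofactors do not see that column,
  so only the entries multiplying them are added. The hypotheses are entrywise so that
  \<open>C\<close> may be a block matrix.\<close>

lemma det_add_column:
  fixes A B C :: "'a::comm_ring_1 mat"
  assumes A: "A \<in> carrier_mat N N" and B: "B \<in> carrier_mat N N" and C: "C \<in> carrier_mat N N"
    and k: "k < N"
    and add: "\<And>i. i < N \<Longrightarrow> C $$ (i, k) = A $$ (i, k) + B $$ (i, k)"
    and eqA: "\<And>i j. \<lbrakk>i < N; j < N; j \<noteq> k\<rbrakk> \<Longrightarrow> C $$ (i, j) = A $$ (i, j)"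
    and eqB: "\<And>i j. \<lbrakk>i < N; j < N; j \<noteq> k\<rbrakk> \<Longrightarrow> C $$ (i, j) = B $$ (i, j)"
  shows "det C = det A + det B"
proof -
  have cof: "cofactor C i k = cofactor D i k"
    if "i < N" and D: "D \<in> carrier_mat N N"
      and eq: "\<And>i j. \<lbrakk>i < N; j < N; j \<noteq> k\<rbrakk> \<Longrightarrow> C $$ (i, j) = D $$ (i, j)" for i D
  proof -
    have "mat_delete C i k = mat_delete D i k"
      using C D k that(1) by (intro eq_matI) (auto simp: mat_delete_def intro!: eq)
    then show ?thesis
      by (simp add: cofactor_def)
  qed
  have "det C = (\<Sum>i<N. C $$ (i, k) * cofactor C i k)"
    by (rule laplace_expansion_column[OF C k])
  also have "\<dots> = (\<Sum>i<N. A $$ (i, k) * cofactor A i k + B $$ (i, k) * cofactor B i k)"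
  proof (rule sum.cong)
    fix i assume "i \<in> {..<N}"
    then have i: "i < N" by simp
    show "C $$ (i, k) * cofactor C i k = A $$ (i, k) * cofactor A i k + B $$ (i, k) * cofactor B i k"
      using cof[OF i A eqA] cof[OF i B eqB] add[OF i] by (metis distrib_right)
  qed simp
  also have "\<dots> = det A + det B"
    by (simp add: sum.distrib laplace_expansion_column[OF A k] laplace_expansion_column[OF B k])
  finally show ?thesis .
qed

text \<open>Every term of the Leibniz formula takes exactly one entry from each row.\<close>

lemma det_scale_rows:
  fixes M :: "nat \<Rightarrow> nat \<Rightarrow> 'a::comm_ring_1"
  shows "det (mat N N (\<lambda>(i, j). w i * M i j)) = (\<Prod>i<N. w i) * det (mat N N (\<lambda>(i, j). M i j))"
proof -
  have *: "(\<Prod>i=0..<N. mat N N (\<lambda>(i, j). w i * M i j) $$ (i, p i))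
      = (\<Prod>i<N. w i) * (\<Prod>i=0..<N. mat N N (\<lambda>(i, j). M i j) $$ (i, p i))"
    if "p permutes {0..<N}" for p
  proof -
    have "p i < N" if "i < N" for i
      using permutes_in_image[OF \<open>p permutes {0..<N}\<close>, of i] that by simp
    then show ?thesis
      by (simp add: prod.distrib atLeast0LessThan)
  qed
  have "det (mat N N (\<lambda>(i, j). w i * M i j)) = (\<Sum>p\<in>{p. p permutes {0..<N}}.
      (\<Prod>i<N. w i) * (signof p * (\<Prod>i=0..<N. mat N N (\<lambda>(i, j). M i j) $$ (i, p i))))"
    unfolding det_def'[OF mat_carrier] by (rule sum.cong) (simp_all only: mem_Collect_eq * mult_ac)
  then show ?thesis
    by (simp only: det_def'[OF mat_carrier] sum_distrib_left)
qed

definition reversal_mat :: "nat \<Rightarrow> 'a::comm_ring_1 mat" where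
  "reversal_mat n = mat n n (\<lambda>(i, j). if i + j + 1 = n then 1 else 0)"

text \<open>The sign is left as a product because \<open>vandermonde_sroot\<close> yields it in the
  same form; the two can be cancelled without evaluating either.\<close>

lemma det_reversal_mat: "det (reversal_mat n :: 'a::comm_ring_1 mat) = (\<Prod>j<n. (- 1) ^ j)"
proof (induction n)
  case 0
  show ?case by (simp add: reversal_mat_def)
next
  case (Suc n)
  have "det (reversal_mat (Suc n) :: 'a mat)
      = (\<Sum>j<Suc n. reversal_mat (Suc n) $$ (0, j) * cofactor (reversal_mat (Suc n)) 0 j)"
    by (rule laplace_expansion_row) (auto simp: reversal_mat_def)
  also have "\<dots> = (\<Sum>j<Suc n. if j = n then cofactor (reversal_mat (Suc n)) 0 n else 0)"
    by (intro sum.cong) (auto simp: reversal_mat_def)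
  also have "\<dots> = cofactor (reversal_mat (Suc n)) 0 n"
    by simp
  also have "mat_delete (reversal_mat (Suc n) :: 'a mat) 0 n = reversal_mat n"
    by (intro eq_matI) (auto simp: mat_delete_def reversal_mat_def)
  then have "cofactor (reversal_mat (Suc n) :: 'a mat) 0 n = (- 1) ^ n * det (reversal_mat n)"
    by (simp add: cofactor_def)
  finally show ?case
    by (simp add: Suc.IH mult.commute)
qed

lemma det_reverse_columns:
  fixes M :: "nat \<Rightarrow> nat \<Rightarrow> 'a::comm_ring_1"
  shows "det (mat n n (\<lambda>(i, j). M i (n - 1 - j)))
    = (\<Prod>j<n. (- 1) ^ j) * det (mat n n (\<lambda>(i, j). M i j))"
proof -
  have "mat n n (\<lambda>(i, j). M i (n - 1 - j)) = mat n n (\<lambda>(i, j). M i j) * reversal_mat n"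
  proof (intro eq_matI)
    fix i j assume "i < dim_row (mat n n (\<lambda>(i, j). M i j) * reversal_mat n)"
      and "j < dim_col (mat n n (\<lambda>(i, j). M i j) * reversal_mat n)"
    then have ij: "i < n" "j < n" by (auto simp: reversal_mat_def)
    have "(mat n n (\<lambda>(i, j). M i j) * reversal_mat n) $$ (i, j)
        = (\<Sum>l<n. M i l * (if l + j + 1 = n then 1 else 0))"
      using ij by (simp add: scalar_prod_def atLeast0LessThan reversal_mat_def)
    also have "\<dots> = (\<Sum>l<n. if l = n - 1 - j then M i l else 0)"
      using ij by (intro sum.cong) auto
    also have "\<dots> = M i (n - 1 - j)"
      using ij by simp
    finally show "mat n n (\<lambda>(i, j). M i (n - 1 - j)) $$ (i, j)
        = (mat n n (\<lambda>(i, j). M i j) * reversal_mat n) $$ (i, j)"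
      using ij by simp
  qed (auto simp: reversal_mat_def)
  moreover have "det (mat n n (\<lambda>(i, j). M i j) * reversal_mat n)
      = det (mat n n (\<lambda>(i, j). M i j)) * det (reversal_mat n)"
    by (rule det_mult[of _ n]) (simp_all add: reversal_mat_def)
  ultimately show ?thesis
    by (simp only: det_reversal_mat mult.commute)
qed

text \<open>\<open>E\<close> records which right-hand columns are added to which left-hand ones. The
  operation \<open>?T\<close> turns both left blocks into the same \<open>C\<close>, so subtracting
  the upper rows from the lower ones by \<open>?L\<close> makes the lower left block vanish. Both
  operations are unitriangular.\<close>

lemma det_two_blocks:
  fixes B B' C E U U' :: "'a::idom mat"
  assumes carrier: "U \<in> carrier_mat n n" "U' \<in> carrier_mat n n" "B \<in> carrier_mat n n"
      "B' \<in> carrier_mat n n" "E \<in> carrier_mat n n"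
    and C: "U + B * E = C" "U' + B' * E = C"
  shows "det (four_block_mat U B U' B') = det C * det (B' - B)"
proof -
  let ?M = "four_block_mat U B U' B'"
  let ?T = "four_block_mat (1\<^sub>m n) (0\<^sub>m n n) E (1\<^sub>m n)"
  let ?L = "four_block_mat (1\<^sub>m n) (0\<^sub>m n n) (- 1\<^sub>m n) (1\<^sub>m n)"
  have carC: "C \<in> carrier_mat n n"
    using carrier C by auto
  have "?M * ?T = four_block_mat C B C B'"
    using carrier C
    by (subst mult_four_block_mat[of _ n n _ n _ n _ _ n _ n]) auto
  then have "?L * (?M * ?T) = four_block_mat C B (0\<^sub>m n n) (B' - B)"
    using carrier carC
    apply (simp add: mult_four_block_mat[of _ n n _ n _ n _ _ n _ n])
    apply (intro arg_cong2[where f = "four_block_mat C B"] eq_matI)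
    apply auto
    done
  then have "det (?L * (?M * ?T)) = det C * det (B' - B)"
    using carrier carC by (simp add: det_four_block_mat_lower_left_zero[of _ n _ n] minus_carrier_mat)
  moreover have "det (?L * (?M * ?T)) = det ?L * (det ?M * det ?T)"
  proof -
    have M: "?M \<in> carrier_mat (n + n) (n + n)" and T: "?T \<in> carrier_mat (n + n) (n + n)"
      and L: "?L \<in> carrier_mat (n + n) (n + n)"
      by (rule four_block_carrier_mat; use carrier in simp)+
    show ?thesis
      unfolding det_mult[OF L mult_carrier_mat[OF M T]] det_mult[OF M T] ..
  qed
  moreover have "det ?L = (1::'a)"
    by (subst det_four_block_mat_upper_right_zero[of _ n _ n]) simp_all
  moreover have "det ?T = 1"
    using carrier by (subst det_four_block_mat_upper_right_zero[of _ n _ n]) simp_all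
  ultimately show ?thesis
    by simp
qed

section \<open>Products over index pairs and the Vandermonde product at x, 1/x\<close>

lemma prod_index_pairs:
  fixes F :: "nat \<Rightarrow> nat \<Rightarrow> 'a::comm_monoid_mult"
  shows "(\<Prod>(i, j)\<in>{(i, j). i < j \<and> j < N}. F i j) = (\<Prod>j<N. \<Prod>i<j. F i j)"
proof -
  have "(\<Prod>(i, j)\<in>{(i, j). i < j \<and> j < N}. F i j)
      = (\<Prod>(j, i)\<in>Sigma {..<N} (\<lambda>j. {..<j}). F i j)"
    by (rule prod.reindex_bij_witness[of _ "\<lambda>(j, i). (i, j)" "\<lambda>(i, j). (j, i)"]) auto
  then show ?thesis
    by (simp add: prod.Sigma)
qed

lemma prod_lessThan_add:
  fixes g :: "nat \<Rightarrow> 'a::comm_monoid_mult"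
  shows "(\<Prod>i<m + k. g i) = (\<Prod>i<m. g i) * (\<Prod>i<k. g (m + i))"
  by (induction k) (auto simp: mult_ac)

text \<open>The square is cut into its diagonal and the mirror pairs (i, j), (j, i). In
  \<open>vandermonde_sroot\<close> it consists of the differences between some x and some
  1/x.\<close>

lemma prod_square_split:
  fixes G :: "nat \<Rightarrow> nat \<Rightarrow> 'a::comm_monoid_mult"
  shows "(\<Prod>j<n. \<Prod>i<n. G i j) = (\<Prod>j<n. G j j * (\<Prod>i<j. G i j * G j i))"
  by (induction n) (simp_all add: prod.distrib mult_ac)

text \<open>
  For \<open>i < 2n\<close> these are the square roots of the arguments \<open>x\<^sub>1, \<dots>, x\<^sub>n, 1/x\<^sub>1, \<dots>, 1/x\<^sub>n\<close> of the
  Schur polynomials.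
\<close>

definition sroot :: "nat \<Rightarrow> (nat \<Rightarrow> 'k::field) \<Rightarrow> nat \<Rightarrow> 'k" where
  "sroot n r i = (if i < n then r i else inverse (r (i - n)))"

text \<open>The factors at \<open>i\<close> and \<open>n + i\<close> cancel. Hence a power
  \<open>c\<close> common to all columns does not change a numerator.\<close>

lemma prod_sroot_powi:
  assumes "\<And>i. i < n \<Longrightarrow> r i \<noteq> 0"
  shows "(\<Prod>i<n + n. sroot n r i powi c) = 1"
  using assms
  by (simp add: prod_lessThan_add sroot_def power_int_inverse field_simps flip: prod.distrib)

text \<open>Each pair i < j contributes four differences, which combine to minus the square of one
  factor of \<open>orth_vandermonde\<close>; one copy serves each character. The differences of x_i
  and 1/x_i supply the prefactor of the identity and the remaining denominator of
  \<open>so_odd\<close>.\<close>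

lemma vandermonde_sroot:
  fixes r :: "nat \<Rightarrow> 'k::field"
  assumes r: "\<And>i. i < n \<Longrightarrow> r i \<noteq> 0"
  shows "(\<Prod>(i, j)\<in>{(i, j). i < j \<and> j < n + n}. (sroot n r i)\<^sup>2 - (sroot n r j)\<^sup>2)
    = (\<Prod>j<n. (- 1) ^ j) * (\<Prod>i<n. r i + inverse (r i)) * (\<Prod>i<n. r i - inverse (r i))
      * (orth_vandermonde (map r [0..<n]))\<^sup>2"
proof -
  define x where "x i = (r i)\<^sup>2" for i
  define v where "v i j = x i + inverse (x i) - x j - inverse (x j)" for i j
  have x: "x i \<noteq> 0" if "i < n" for i
    using r[OF that] by (simp add: x_def)
  \<comment> \<open>Both sides follow from \<open>v i j\<close> being (x_i - x_j) (x_i x_j - 1) /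
    (x_i x_j).\<close>
  have pair: "(x i - x j) * (inverse (x i) - inverse (x j))
      * ((x i - inverse (x j)) * (x j - inverse (x i))) = - ((v i j)\<^sup>2)"
    if "i < n" "j < n" for i j
    using x[OF that(1)] x[OF that(2)] by (simp add: v_def field_simps power2_eq_square)
  have diag: "x i - inverse (x i) = (r i + inverse (r i)) * (r i - inverse (r i))" if "i < n" for i
    using r[OF that] by (simp add: x_def field_simps power2_eq_square)
  have ov: "orth_vandermonde (map r [0..<n]) = (\<Prod>j<n. \<Prod>i<j. v i j)"
  proof -
    have "orth_vandermonde (map r [0..<n]) = (\<Prod>(i, j)\<in>{(i, j). i < j \<and> j < n}. v i j)"
      unfolding orth_vandermonde_def by (intro prod.cong) (auto simp: v_def x_def)
    then show ?thesis
      by (simp add: prod_index_pairs)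
  qed
  \<comment> \<open>Cutting the index range at \<open>n\<close> separates the pairs within x, the
    mixed pairs and the pairs within 1/x.\<close>
  have "(\<Prod>(i, j)\<in>{(i, j). i < j \<and> j < n + n}. (sroot n r i)\<^sup>2 - (sroot n r j)\<^sup>2)
      = (\<Prod>j<n. \<Prod>i<j. x i - x j)
        * ((\<Prod>j<n. \<Prod>i<n. x i - inverse (x j)) * (\<Prod>j<n. \<Prod>i<j. inverse (x i) - inverse (x j)))"
    by (simp add: prod_index_pairs prod_lessThan_add sroot_def x_def power_inverse prod.distrib)
  also have "(\<Prod>j<n. \<Prod>i<n. x i - inverse (x j))
      = (\<Prod>j<n. (x j - inverse (x j)) * (\<Prod>i<j. (x i - inverse (x j)) * (x j - inverse (x i))))"
    by (rule prod_square_split)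
  also have "(\<Prod>j<n. \<Prod>i<j. x i - x j) * (\<dots> * (\<Prod>j<n. \<Prod>i<j. inverse (x i) - inverse (x j)))
      = (\<Prod>j<n. (x j - inverse (x j)) * (\<Prod>i<j. (x i - x j) * (inverse (x i) - inverse (x j))
          * ((x i - inverse (x j)) * (x j - inverse (x i)))))"
    by (simp add: prod.distrib mult_ac)
  also have "\<dots> = (\<Prod>j<n. (r j + inverse (r j)) * (r j - inverse (r j)) * (\<Prod>i<j. - ((v i j)\<^sup>2)))"
    by (intro prod.cong arg_cong2[where f = "(*)"] pair diag) auto
  \<comment> \<open>There are \<open>j\<close> indices below \<open>j\<close>, hence
    \<open>j\<close> minus signs; together they give the sign of the column reversal.\<close>
  also have "\<dots> = (\<Prod>j<n. (r j + inverse (r j)) * (r j - inverse (r j)) * ((- 1) ^ j * (\<Prod>i<j. v i j)\<^sup>2))"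
    by (simp add: prod_uminus prod_power_distrib)
  finally show ?thesis
    by (simp add: prod.distrib prod_power_distrib ov mult_ac)
qed

section \<open>Numerators of the Schur polynomials\<close>

text \<open>The exponents in \<open>f1\<close> are b_1, ..., b_n, -b_(n-1), ..., -b_0; in
  \<open>f2\<close> only b_n is replaced by -b_n. In the sum of the two determinants this one column
  is symmetric already, and every other left column has its mirror image among the right
  ones.\<close>

lemma det_sum_factorization:
  fixes r :: "nat \<Rightarrow> 'k::field" and b :: "nat \<Rightarrow> int"
  assumes n: "n \<ge> 1"
  defines "f1 \<equiv> \<lambda>j. if j < n then b (j + 1) else - b (n + n - 1 - j)"
    and "f2 \<equiv> \<lambda>j. if j + 1 < n then b (j + 1) else - b (n + n - 1 - j)"
  shows "det (mat (n + n) (n + n) (\<lambda>(i, j). sroot n r i powi f1 j))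
      + det (mat (n + n) (n + n) (\<lambda>(i, j). sroot n r i powi f2 j))
    = (\<Prod>j<n. (- 1) ^ j)
      * det (mat n n (\<lambda>(i, j). r i powi b j - inverse (r i) powi b j))
      * det (mat n n (\<lambda>(i, j). r i powi b (j + 1) + inverse (r i) powi b (j + 1)))"
proof -
  \<comment> \<open>Column \<open>n - 1\<close> is the one where \<open>f1\<close> and
    \<open>f2\<close> differ; there \<open>g\<close> is the sum of both entries.\<close>
  define g where "g y j = (if j = n - 1 then y powi b n + y powi (- b n) else y powi b (j + 1))"
    for y :: 'k and j
  define U where "U = mat n n (\<lambda>(i, j). g (r i) j)"
  define U' where "U' = mat n n (\<lambda>(i, j). g (inverse (r i)) j)"
  define B where "B = mat n n (\<lambda>(i, j). r i powi (- b (n - 1 - j)))"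
  define B' where "B' = mat n n (\<lambda>(i, j). inverse (r i) powi (- b (n - 1 - j)))"
  \<comment> \<open>Column \<open>l\<close> of \<open>B\<close> has exponent
    \<open>- b (n - 1 - l)\<close>, so the mirror image of left column \<open>j\<close> sits at
    \<open>l = n - 2 - j\<close>. Column \<open>n - 1\<close> of \<open>E\<close> is zero, since
    nothing is to be added to the symmetric column.\<close>
  define E where "E = mat n n (\<lambda>(l, j). if l + j + 2 = n then 1 else (0::'k))"
  define C where "C = mat n n (\<lambda>(i, j). r i powi b (j + 1) + inverse (r i) powi b (j + 1))"
  have carrier: "U \<in> carrier_mat n n" "U' \<in> carrier_mat n n" "B \<in> carrier_mat n n"
      "B' \<in> carrier_mat n n" "E \<in> carrier_mat n n"
    by (simp_all add: U_def U'_def B_def B'_def E_def)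
  have "det (four_block_mat U B U' B')
      = det (mat (n + n) (n + n) (\<lambda>(i, j). sroot n r i powi f1 j))
      + det (mat (n + n) (n + n) (\<lambda>(i, j). sroot n r i powi f2 j))"
    by (rule det_add_column[where N = "n + n" and k = "n - 1"])
      (use n carrier in \<open>auto simp: U_def U'_def B_def B'_def g_def sroot_def f1_def f2_def\<close>)
  moreover have "det (four_block_mat U B U' B') = det C * det (B' - B)"
  proof (rule det_two_blocks[OF carrier])
    have times_E: "mat n n (\<lambda>(i, j). h i (n - 1 - j)) * E
        = mat n n (\<lambda>(i, j). if j = n - 1 then 0 else h i (j + 1))" for h :: "nat \<Rightarrow> nat \<Rightarrow> 'k"
    proof -
      have "(\<Sum>l<n. h i (n - 1 - l) * (if l + j + 2 = n then 1 else 0))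
          = (if j = n - 1 then 0 else h i (j + 1))" if "j < n" for i j
      proof -
        \<comment> \<open>For \<open>j = n - 1\<close> the truncated difference
          \<open>n - 2 - j\<close> is the valid index 0, so the inner case distinction has to make
          that summand vanish.\<close>
        have "(\<Sum>l<n. h i (n - 1 - l) * (if l + j + 2 = n then 1 else 0))
            = (\<Sum>l<n. if l = n - 2 - j then (if j = n - 1 then 0 else h i (j + 1)) else 0)"
          using that by (intro sum.cong) (auto intro!: arg_cong[where f = "h i"])
        also have "\<dots> = (if j = n - 1 then 0 else h i (j + 1))"
          using that by simp
        finally show ?thesis .
      qed
      then show ?thesis
        by (intro eq_matI) (auto simp: E_def scalar_prod_def atLeast0LessThan)
    qed
    show "U + B * E = C" "U' + B' * E = C"
      unfolding B_def B'_def times_E[of "\<lambda>i m. r i powi (- b m)"]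
        times_E[of "\<lambda>i m. inverse (r i) powi (- b m)"]
      using n by (auto intro!: eq_matI
        simp: U_def U'_def C_def g_def power_int_minus power_int_inverse)
  qed
  moreover have "B' - B
      = mat n n (\<lambda>(i, j). r i powi b (n - 1 - j) - inverse (r i) powi b (n - 1 - j))"
    by (rule eq_matI) (auto simp: B_def B'_def power_int_minus power_int_inverse)
  moreover have "det (mat n n (\<lambda>(i, j). r i powi b (n - 1 - j) - inverse (r i) powi b (n - 1 - j)))
      = (\<Prod>j<n. (- 1) ^ j) * det (mat n n (\<lambda>(i, j). r i powi b j - inverse (r i) powi b j))"
    by (rule det_reverse_columns)
  ultimately show ?thesis
    by (simp add: C_def mult_ac)
qed

text \<open>Exponents are doubled because the arguments are squares of \<open>sroot\<close>. The
  shift \<open>c\<close> scales each row by a power of its root, and these powers multiply to 1;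
  this removes the dependence on k1 and k2.\<close>

lemma schur_sroot:
  fixes r :: "nat \<Rightarrow> 'k::field"
  assumes r: "\<And>i. i < n \<Longrightarrow> r i \<noteq> 0"
    and len: "length \<mu> = n + n"
    and exps: "\<And>j. j < n + n \<Longrightarrow> 2 * \<lfloor>\<mu> ! j + of_nat (n + n - 1 - j)\<rfloor> = c + f j"
  shows "schur \<mu> (map (\<lambda>i. (sroot n r i)\<^sup>2) [0..<n + n])
    = det (mat (n + n) (n + n) (\<lambda>(i, j). sroot n r i powi f j))
      / (\<Prod>(i, j)\<in>{(i, j). i < j \<and> j < n + n}. (sroot n r i)\<^sup>2 - (sroot n r j)\<^sup>2)"
proof -
  have nz: "sroot n r i \<noteq> 0" if "i < n + n" for i
    using r that by (auto simp: sroot_def)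
  have "mat (n + n) (n + n)
        (\<lambda>(i, j). (map (\<lambda>i. (sroot n r i)\<^sup>2) [0..<n + n] ! i) powi \<lfloor>\<mu> ! j + of_nat (n + n - 1 - j)\<rfloor>)
      = mat (n + n) (n + n) (\<lambda>(i, j). sroot n r i powi c * sroot n r i powi f j)"
  proof (rule cong_mat)
    fix i j assume "i < n + n" "j < n + n"
    then show "(case (i, j) of (i, j) \<Rightarrow>
          (map (\<lambda>i. (sroot n r i)\<^sup>2) [0..<n + n] ! i) powi \<lfloor>\<mu> ! j + of_nat (n + n - 1 - j)\<rfloor>)
        = (case (i, j) of (i, j) \<Rightarrow> sroot n r i powi c * sroot n r i powi f j)"
      using nz exps[of j] by (simp add: power_int_power flip: power_int_add del: of_nat_diff)
  qed auto
  moreover have "(\<Prod>(i, j)\<in>{(i, j). i < j \<and> j < n + n}.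
        map (\<lambda>i. (sroot n r i)\<^sup>2) [0..<n + n] ! i - map (\<lambda>i. (sroot n r i)\<^sup>2) [0..<n + n] ! j)
      = (\<Prod>(i, j)\<in>{(i, j). i < j \<and> j < n + n}. (sroot n r i)\<^sup>2 - (sroot n r j)\<^sup>2)"
    by (intro prod.cong) auto
  ultimately show ?thesis
    using prod_sroot_powi[of n r c] r by (simp add: schur_def len Let_def det_scale_rows)
qed

section \<open>Nonvanishing in the field of rational functions\<close>

lemma Fract_eq_0_iff: "Fract a 1 = 0 \<longleftrightarrow> a = 0"
  by (simp add: Zero_fract_def eq_fract)

lemma xsqrt_nonzero: "(xsqrt i :: 'a::idom ratfun) \<noteq> 0"
  using xvar_nonzero[of i, where 'a = 'a] by (auto simp: xvar_def)

text \<open>Squaring removes the sign and leads back to \<open>xvar_neq_inverse\<close>. The result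
  allows the prefactor of the identity to be cancelled.\<close>

lemma xsqrt_plus_inverse_nonzero: "xsqrt i + inverse (xsqrt i) \<noteq> (0 :: 'a::idom ratfun)"
proof
  assume "xsqrt i + inverse (xsqrt i) = (0 :: 'a ratfun)"
  then have "xsqrt i = - inverse (xsqrt i :: 'a ratfun)"
    by (simp add: eq_neg_iff_add_eq_0)
  then have "xvar i = inverse (xvar i :: 'a ratfun)"
    by (metis xvar_def power2_minus power_inverse)
  then show False
    using xvar_neq_inverse by blast
qed

text \<open>The constant coefficient of 1 + 1 is 2. This is for cancelling the denominator 2 of
  \<open>o_even\<close> when the last entry is 0.\<close>

lemma two_neq_zero_ratfun: "(2 :: 'a::{idom, ring_char_0} ratfun) \<noteq> 0"
proof -
  have "Poly_Mapping.lookup (1 + 1 :: (nat \<Rightarrow>\<^sub>0 nat) \<Rightarrow>\<^sub>0 'a) 0 = 2"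
    unfolding lookup_add lookup_one by (metis when_simps(1) one_add_one)
  then have "(1 + 1 :: (nat \<Rightarrow>\<^sub>0 nat) \<Rightarrow>\<^sub>0 'a) \<noteq> 0"
    using zero_neq_numeral[of "num.Bit0 num.One", where 'a = 'a]
    by (intro notI) (simp only: lookup_zero)
  moreover have "(2 :: 'a ratfun) = Fract (1 + 1) 1"
    unfolding one_add_one[symmetric] One_fract_def add_fract[OF one_neq_zero one_neq_zero]
    by (simp only: mult_1_left)
  ultimately show ?thesis
    by (simp only: Fract_eq_0_iff not_False_eq_True)
qed

section \<open>Integrality of the exponents and assembly of the identity\<close>

text \<open>This unifies the integer and half-integer cases: all that matters later is that 2k and
  the doubled entries are integers of equal parity, so that k plus or minus an entry is an integer
  and the floors in \<open>schur\<close> are exact.\<close>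

lemma half_integers_doubled:
  assumes "(is_partition (map lam [0..<n+1]) \<and> k \<in> \<int>)
      \<or> (is_half_partition (map lam [0..<n+1]) \<and> half_integer k)"
  obtains p q where "k = of_int q / 2" "\<And>j. j \<le> n \<Longrightarrow> lam j = of_int (p j) / 2"
    "\<And>j. j \<le> n \<Longrightarrow> even (q + p j)"
  using assms
proof (elim disjE conjE)
  assume part: "is_partition (map lam [0..<n+1])" and "k \<in> \<int>"
  show thesis
  proof (rule that[of "2 * \<lfloor>k\<rfloor>" "\<lambda>j. 2 * \<lfloor>lam j\<rfloor>"])
    show "k = of_int (2 * \<lfloor>k\<rfloor>) / 2"
      using \<open>k \<in> \<int>\<close> by (elim Ints_cases) simp
  next
    fix j assume "j \<le> n"
    then have "lam j \<in> \<nat>"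
      using part by (auto simp: is_partition_def)
    then show "lam j = of_int (2 * \<lfloor>lam j\<rfloor>) / 2"
      by (elim Nats_cases) simp
  qed simp
next
  assume part: "is_half_partition (map lam [0..<n+1])" and "half_integer k"
  from \<open>half_integer k\<close> obtain q where q: "odd q" "k = of_int q / 2"
    by (auto simp: half_integer_def)
  have lam: "odd \<lfloor>2 * lam j\<rfloor> \<and> lam j = of_int \<lfloor>2 * lam j\<rfloor> / 2" if "j \<le> n" for j
  proof -
    have "half_integer (lam j)"
      using part that by (auto simp: is_half_partition_def)
    then obtain m where "odd m" "2 * lam j = of_int m"
      by (auto simp: half_integer_def)
    then show ?thesis
      by simp
  qed
  show thesis
  proof (rule that[of q "\<lambda>j. \<lfloor>2 * lam j\<rfloor>"])
    fix j assume "j \<le> n"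
    from lam[OF this] show "lam j = of_int \<lfloor>2 * lam j\<rfloor> / 2" "even (q + \<lfloor>2 * lam j\<rfloor>)"
      using q(1) by (blast, metis even_add)
  qed (rule q(2))
qed

lemma two_floor_half: "even m \<Longrightarrow> 2 * \<lfloor>of_int m / 2 :: rat\<rfloor> = m"
  by (auto elim!: evenE)

theorem theorem2:
  fixes n :: nat and lam :: "nat \<Rightarrow> rat" and k1 k2 :: rat
  assumes "n \<ge> 1"
    and "(is_partition (map lam [0..<n+1]) \<and> k1 \<in> \<int> \<and> k2 \<in> \<int>)
       \<or> (is_half_partition (map lam [0..<n+1]) \<and> half_integer k1 \<and> half_integer k2)"
    and "k1 \<ge> lam 0" and "k2 \<ge> lam 0"
  shows
    "(\<Prod>i=1..n. xsqrt i + inverse (xsqrt i)) *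
      (schur (map (\<lambda>i. k1 + lam i) [1..<n+1] @ map (\<lambda>i. k1 - lam i) (rev [0..<n]))
         (map xvar [1..<n+1] @ map (\<lambda>i. inverse (xvar i)) [1..<n+1])
       + schur (map (\<lambda>i. k2 + lam i) [1..<n] @ map (\<lambda>i. k2 - lam i) (rev [0..<n+1]))
         (map xvar [1..<n+1] @ map (\<lambda>i. inverse (xvar i)) [1..<n+1]))
     = (1 + (if lam n = 0 then 1 else 0))
       * so_odd (map (\<lambda>i. lam i + 1/2) [0..<n]) (map xsqrt [1..<n+1])
       * (o_even (map lam [1..<n+1]) (map xsqrt [1..<n+1])
          :: 'a::{idom, ring_char_0} ratfun)"
proof -
  \<comment> \<open>The variables are numbered from 1, lists and matrices from 0.\<close>
  define r where "r i = (xsqrt (i + 1) :: 'a ratfun)" for i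
  have r: "r i \<noteq> 0" for i
    by (simp add: r_def xsqrt_nonzero)
  \<comment> \<open>This is twice the exponent a_j = lam_j + n - j, that is, the exponent with
    respect to the square root.\<close>
  define b where "b j = \<lfloor>2 * lam j\<rfloor> + 2 * (int n - int j)" for j
  define f1 where "f1 j = (if j < n then b (j + 1) else - b (n + n - 1 - j))" for j
  define f2 where "f2 j = (if j + 1 < n then b (j + 1) else - b (n + n - 1 - j))" for j
  define V where "V = (\<Prod>(i, j)\<in>{(i, j). i < j \<and> j < n + n}. (sroot n r i)\<^sup>2 - (sroot n r j)\<^sup>2)"
  \<comment> \<open>The second and third formula cover the left and right columns of a Schur
    numerator; their common part \<open>\<lfloor>2 * k\<rfloor> + 2 * int n\<close> is the shift
    \<open>c\<close> for \<open>schur_sroot\<close>.\<close>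
  have halves: "b j = \<lfloor>2 * (lam j + of_nat (n - j))\<rfloor>"
      "k \<in> {k1, k2} \<Longrightarrow> 2 * \<lfloor>k + lam j + of_nat (n + n - j)\<rfloor> = \<lfloor>2 * k\<rfloor> + 2 * int n + b j"
      "k \<in> {k1, k2} \<Longrightarrow> 2 * \<lfloor>k - lam j + of_nat j\<rfloor> = \<lfloor>2 * k\<rfloor> + 2 * int n - b j"
    if "j \<le> n" for j k
  proof -
    show "b j = \<lfloor>2 * (lam j + of_nat (n - j))\<rfloor>"
    proof -
      have "2 * (lam j + of_nat (n - j)) = 2 * lam j + of_int (2 * (int n - int j))"
        using that by (simp add: of_nat_diff)
      then show ?thesis
        by (simp only: b_def floor_add_int)
    qed
    assume "k \<in> {k1, k2}"
    then have "(is_partition (map lam [0..<n+1]) \<and> k \<in> \<int>)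
        \<or> (is_half_partition (map lam [0..<n+1]) \<and> half_integer k)"
      using assms(2) by auto
    then obtain p q where pq: "k = of_int q / 2" "\<And>j. j \<le> n \<Longrightarrow> lam j = of_int (p j) / 2"
        "\<And>j. j \<le> n \<Longrightarrow> even (q + p j)"
      by (rule half_integers_doubled) blast
    have b: "b j = p j + 2 * (int n - int j)"
      by (simp add: b_def pq(2)[OF that])
    have k: "\<lfloor>2 * k\<rfloor> = q"
      by (simp add: pq(1))
    have "k + lam j + of_nat (n + n - j) = of_int (q + p j + 2 * int (n + n - j)) / 2"
      by (simp add: pq(1) pq(2)[OF that] field_simps)
    moreover have "even (q + p j + 2 * int (n + n - j))"
      using pq(3)[OF that] by simp
    ultimately have "2 * \<lfloor>k + lam j + of_nat (n + n - j)\<rfloor> = q + p j + 2 * int (n + n - j)"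
      by (simp only: two_floor_half)
    then show "2 * \<lfloor>k + lam j + of_nat (n + n - j)\<rfloor> = \<lfloor>2 * k\<rfloor> + 2 * int n + b j"
      using that by (simp add: b k of_nat_diff)
    have "k - lam j + of_nat j = of_int (q - p j + 2 * int j) / 2"
      by (simp add: pq(1) pq(2)[OF that] field_simps)
    moreover have "even (q - p j + 2 * int j)"
      using pq(3)[OF that] by simp
    ultimately have "2 * \<lfloor>k - lam j + of_nat j\<rfloor> = q - p j + 2 * int j"
      by (simp only: two_floor_half)
    then show "2 * \<lfloor>k - lam j + of_nat j\<rfloor> = \<lfloor>2 * k\<rfloor> + 2 * int n - b j"
      using that by (simp add: b k)
  qed
  have args: "map xvar [1..<n+1] @ map (\<lambda>i. inverse (xvar i)) [1..<n+1]
      = map (\<lambda>i. (sroot n r i)\<^sup>2) [0..<n + n]"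
    by (rule nth_equalityI)
      (auto simp: nth_append sroot_def r_def xvar_def power_inverse simp del: upt_Suc)
  have roots: "map xsqrt [1..<n+1] = map r [0..<n]"
    by (rule nth_equalityI) (auto simp: r_def simp del: upt_Suc)
  have schur1: "schur (map (\<lambda>i. k1 + lam i) [1..<n+1] @ map (\<lambda>i. k1 - lam i) (rev [0..<n]))
      (map (\<lambda>i. (sroot n r i)\<^sup>2) [0..<n + n])
    = det (mat (n + n) (n + n) (\<lambda>(i, j). sroot n r i powi f1 j)) / V"
    unfolding V_def
  proof (rule schur_sroot[where c = "\<lfloor>2 * k1\<rfloor> + 2 * int n"])
    fix j assume "j < n + n"
    then show "2 * \<lfloor>(map (\<lambda>i. k1 + lam i) [1..<n+1] @ map (\<lambda>i. k1 - lam i) (rev [0..<n])) ! j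
        + of_nat (n + n - 1 - j)\<rfloor> = \<lfloor>2 * k1\<rfloor> + 2 * int n + f1 j"
      \<comment> \<open>Left columns belong to the entry of index \<open>j + 1\<close>, right
        columns to that of index \<open>n + n - 1 - j\<close>.\<close>
      using halves(2)[of "j + 1" k1] halves(3)[of "n + n - 1 - j" k1]
      by (auto simp: nth_append rev_nth f1_def simp del: upt_Suc of_nat_diff)
  qed (auto simp: r)
  have schur2: "schur (map (\<lambda>i. k2 + lam i) [1..<n] @ map (\<lambda>i. k2 - lam i) (rev [0..<n+1]))
      (map (\<lambda>i. (sroot n r i)\<^sup>2) [0..<n + n])
    = det (mat (n + n) (n + n) (\<lambda>(i, j). sroot n r i powi f2 j)) / V"
    unfolding V_def
  proof (rule schur_sroot[where c = "\<lfloor>2 * k2\<rfloor> + 2 * int n"])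
    fix j assume "j < n + n"
    then show "2 * \<lfloor>(map (\<lambda>i. k2 + lam i) [1..<n] @ map (\<lambda>i. k2 - lam i) (rev [0..<n+1])) ! j
        + of_nat (n + n - 1 - j)\<rfloor> = \<lfloor>2 * k2\<rfloor> + 2 * int n + f2 j"
      \<comment> \<open>Now column \<open>n - 1\<close> falls under the third formula, with index
        \<open>n\<close>.\<close>
      using halves(2)[of "j + 1" k2] halves(3)[of "n + n - 1 - j" k2] \<open>n \<ge> 1\<close>
      by (auto simp: nth_append rev_nth f2_def simp del: upt_Suc of_nat_diff)
  qed (use \<open>n \<ge> 1\<close> r in auto)
  define dso where "dso = det (mat n n (\<lambda>(i, j). r i powi b j - inverse (r i) powi b j))"
  define deven where
    "deven = det (mat n n (\<lambda>(i, j). r i powi b (j + 1) + inverse (r i) powi b (j + 1)))"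
  define sgn :: "'a ratfun" where "sgn = (\<Prod>j<n. (- 1) ^ j)"
  define Q where "Q = (\<Prod>i<n. r i + inverse (r i))"
  define P where "P = (\<Prod>i<n. r i - inverse (r i))"
  define W where "W = orth_vandermonde (map r [0..<n])"
  have so: "so_odd (map (\<lambda>i. lam i + 1/2) [0..<n]) (map r [0..<n]) = dso / (P * W)"
  proof -
    \<comment> \<open>The 1/2 in the entry and the 1/2 in the exponent of \<open>so_odd\<close> add
      up to the 1 that leads from \<open>n - 1 - j\<close> to \<open>n - j\<close>.\<close>
    have exps: "\<lfloor>2 * (lam j + 1/2 + of_nat (n - 1 - j) + 1/2)\<rfloor> = b j" if "j < n" for j
    proof -
      have "lam j + 1/2 + of_nat (n - 1 - j) + 1/2 = lam j + of_nat (n - j)"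
        using that by (simp add: of_nat_diff)
      then show ?thesis
        using halves(1)[of j] that by simp
    qed
    have nths: "map r [0..<n] ! j = r j" "map (\<lambda>i. lam i + 1/2) [0..<n] ! j = lam j + 1/2"
      if "j < n" for j
      using that by simp_all
    have "mat n n (\<lambda>(i, j).
          half_power (map r [0..<n] ! i) (map (\<lambda>i. lam i + 1/2) [0..<n] ! j + of_nat (n - 1 - j) + 1/2)
          - half_power (inverse (map r [0..<n] ! i))
              (map (\<lambda>i. lam i + 1/2) [0..<n] ! j + of_nat (n - 1 - j) + 1/2))
        = mat n n (\<lambda>(i, j). r i powi b j - inverse (r i) powi b j)"
      by (intro cong_mat) (simp_all only: half_power_def nths exps prod.case)
    then show ?thesis
      by (simp add: so_odd_def dso_def P_def W_def)
  qed
  \<comment> \<open>The factor 1 or 2 stays on the left so that it cancels against the denominator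
    of \<open>o_even\<close>. The entries start at index 1, so column \<open>j\<close> carries
    \<open>b (j + 1)\<close>.\<close>
  have ev: "(1 + (if lam n = 0 then 1 else 0)) * o_even (map lam [1..<n+1]) (map r [0..<n])
      = deven / W"
  proof -
    have "\<lfloor>2 * (lam (j + 1) + of_nat (n - 1 - j))\<rfloor> = b (j + 1)" if "j < n" for j
      using halves(1)[of "j + 1"] that by simp
    then have "mat n n (\<lambda>(i, j).
          half_power (map r [0..<n] ! i) (map lam [1..<n+1] ! j + of_nat (n - 1 - j))
          + half_power (inverse (map r [0..<n] ! i)) (map lam [1..<n+1] ! j + of_nat (n - 1 - j)))
        = mat n n (\<lambda>(i, j). r i powi b (j + 1) + inverse (r i) powi b (j + 1))"
      by (intro cong_mat) (auto simp: half_power_def simp del: upt_Suc)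
    moreover have "map lam [1..<n+1] ! (n - 1) = lam n"
      using \<open>n \<ge> 1\<close> by (simp del: upt_Suc)
    ultimately show ?thesis
      using two_neq_zero_ratfun[where 'a = 'a]
      by (simp add: o_even_def deven_def W_def del: upt_Suc)
  qed
  have "(\<Prod>i=1..n. xsqrt i + inverse (xsqrt i)) = Q"
    unfolding Q_def r_def
    by (rule prod.reindex_bij_witness[of _ "\<lambda>i. i + 1" "\<lambda>i. i - 1"]) auto
  moreover have "Q \<noteq> 0"
    by (simp add: Q_def r_def xsqrt_plus_inverse_nonzero del: One_nat_def)
  moreover have "V = sgn * Q * P * W\<^sup>2"
    unfolding V_def sgn_def Q_def P_def W_def by (rule vandermonde_sroot) (rule r)
  moreover have "det (mat (n + n) (n + n) (\<lambda>(i, j). sroot n r i powi f1 j))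
      + det (mat (n + n) (n + n) (\<lambda>(i, j). sroot n r i powi f2 j)) = sgn * dso * deven"
    unfolding sgn_def dso_def deven_def f1_def f2_def
    by (rule det_sum_factorization[OF \<open>n \<ge> 1\<close>])
  moreover have "sgn \<noteq> 0"
    by (simp add: sgn_def)
  \<comment> \<open>Once \<open>V\<close> is factored, \<open>Q\<close> cancels against the
    prefactor and \<open>sgn\<close> against the sign of the numerator; \<open>P * W\<^sup>2\<close>
    remains as the product of the two character denominators.\<close>
  ultimately have "(\<Prod>i=1..n. xsqrt i + inverse (xsqrt i))
        * (det (mat (n + n) (n + n) (\<lambda>(i, j). sroot n r i powi f1 j)) / V
          + det (mat (n + n) (n + n) (\<lambda>(i, j). sroot n r i powi f2 j)) / V)
      = dso / (P * W) * (deven / W)"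
    by (simp add: power2_eq_square flip: add_divide_distrib)
  then show ?thesis
    unfolding args roots schur1 schur2 so ev[symmetric] by (simp only: mult_ac)
qed

end
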